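(* Let $I=[a,b]$, let $g:I\times\mathbb{R}\times\mathbb{R}\to\mathbb{R}$ and $x_a\in\mathbb{R}$. Let $\tau:I\to I$ be a measurable function such that $\tau(t)\le t$ for a.a. $t\in I$, and assume that the following conditions hold: (1) For all $x,y\in\mathbb{R}$ the function $g(\cdot,x,y)$ is measurable. (2) There exists $\psi\in L^1(I)$ such that for a.a. $t\in I$ and all $x,y\in\mathbb{R}$ we have $|g(t,x,y)|\le\psi(t)$. (3) There exist nonnegative functions $L_1,L_2\in L^1(I)$ such that $$|g(t,x,y)-g(t,\overline{x},\overline{y})|\le L_1(t)|x-\overline{x}|+L_2(t)|y-\overline{y}|$$ for a.a. $t\in I$ and all $x,y,\overline{x},\overline{y}\in\mathbb{R}$. Then the initial value problem $$x'(t)=g(t,x(t),x(\tau(t)))\ \text{ for a.a. } t\in I,\qquad x(a)=x_a,$$ has a unique absolutely continuous solution $x:I\to\mathbb{R}$.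
   Context: $I=[a,b]$ is a compact real interval; "a.a." means almost all with respect to Lebesgue measure, and measurability is Lebesgue measurability. An absolutely continuous solution is an absolutely continuous function $x:I\to\mathbb{R}$ satisfying the differential equation for almost all $t\in I$ and the initial condition. *)

theory Defs
  imports "HOL-Analysis.Analysis"
begin

text \<open>Absolute continuity of a real function on an interval \<open>S\<close> (the library only has
  the notion of the same name for measures).  Degenerate intervals \<open>u i = v i\<close> are allowed; they
  contribute \<open>0\<close> to both sums.\<close>

definition absolutely_continuous_on :: "real set \<Rightarrow> (real \<Rightarrow> real) \<Rightarrow> bool" where
  "absolutely_continuous_on S f \<longleftrightarrow>
    (\<forall>\<epsilon>>0. \<exists>\<delta>>0. \<forall>(n::nat) u v.
      (\<forall>i<n. u i \<le> v i \<and> {u i..v i} \<subseteq> S) \<and>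
      disjoint_family_on (\<lambda>i. {u i<..<v i}) {..<n} \<and>
      (\<Sum>i<n. v i - u i) < \<delta>
      \<longrightarrow> (\<Sum>i<n. \<bar>f (v i) - f (u i)\<bar>) < \<epsilon>)"

text \<open>The predicate only depends on the values of \<open>x\<close> on \<open>{a..b}\<close>, provided that \<open>\<tau>\<close> maps \<open>{a..b}\<close>
  to itself: the derivative is taken within \<open>{a..b}\<close>.\<close>

definition is_ac_solution ::
  "real \<Rightarrow> real \<Rightarrow> (real \<Rightarrow> real \<Rightarrow> real \<Rightarrow> real) \<Rightarrow> (real \<Rightarrow> real) \<Rightarrow> real \<Rightarrow> (real \<Rightarrow> real) \<Rightarrow> bool" where
  "is_ac_solution a b g \<tau> xa x \<longleftrightarrow>
    absolutely_continuous_on {a..b} x \<and>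
    (AE t in lebesgue_on {a..b}.
      (x has_real_derivative g t (x t) (x (\<tau> t))) (at t within {a..b})) \<and>
    x a = xa"

end

theory Submission
  imports Defs
begin

text \<open>
  A function \<open>x\<close> is an absolutely continuous solution exactly when it is continuous and a fixed point
  of the Picard operator \<open>P x t = xa + \<integral>\<^sub>a\<^sup>t g(s, x(s), x(\<tau>(s))) ds\<close>.  So the problem is one of fixed
  points, solved by Banach's theorem on the continuous functions on \<open>[a,b]\<close>.  Two ideas are involved.

  \<^bold>\<open>From the differential equation to the integral equation.\<close>  The equivalence is the fundamental theorem
  of calculus for the Lebesgue integral, in both directions: the indefinite integral of an integrable
  function is absolutely continuous with the expected derivative almost everywhere
  (\<open>absolutely_continuous_on_integral\<close>, \<open>lebesgue_differentiation_interval\<close>), and an absolutely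
  continuous function is recovered by integrating its derivative
  (\<open>fundamental_theorem_of_calculus_absolutely_continuous\<close>).  The differentiation theorem is obtained from
  Henstock's lemma and the Vitali covering theorem: at a point where differentiation fails, arbitrarily
  short intervals make a Henstock error proportional to their length, and a disjoint Vitali selection
  of them has small total error, hence small total length.  The converse rests on a monotonicity principle,
  \<open>absolutely_continuous_nonneg_derivative_imp_le\<close>, in which absolute continuity controls
  the increments over a small neighbourhood of the exceptional null set.

  \<^bold>\<open>The contraction.\<close>  Let \<open>\<Lambda>(t) = \<integral>\<^sub>a\<^sup>t (L1 + L2)\<close>.  If \<open>\<bar>x - y\<bar> \<le> d exp(2 \<Lambda>)\<close> on \<open>[a,b]\<close>, the same
  bound holds for \<open>\<bar>x \<circ> \<tau> - y \<circ> \<tau>\<bar>\<close>, because \<open>\<tau>(s) \<le> s\<close> and \<open>\<Lambda>\<close> is increasing.  The Lipschitz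
  condition therefore gives
  \<open>\<bar>P x (t) - P y (t)\<bar> \<le> d \<integral>\<^sub>a\<^sup>t (L1 + L2) exp(2 \<Lambda>) = d (exp(2 \<Lambda>(t)) - 1) / 2\<close>,
  so \<open>P\<close> halves distances in the norm \<open>sup \<bar>x\<bar> exp(-2 \<Lambda>)\<close> (\<open>picard_contraction\<close>).  This is where
  \<open>\<tau>(s) \<le> s\<close> enters: an argument ahead of \<open>s\<close> could carry a larger weight than \<open>s\<close>.

  That the integrand \<open>g(s, x(s), x(\<tau>(s)))\<close> is measurable is the classical fact on functions that are
  measurable in \<open>s\<close> and continuous in the other variables (\<open>borel_measurable_caratheodory_compose\<close>).
\<close>

section \<open>Differentiation of indefinite integrals\<close>

text \<open>
  Fix a gauge for which Henstock's lemma bounds the total error of a fine partial division by \<open>\<mu> e\<close>.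
  The bad intervals that are fine for this gauge form a Vitali cover of the exceptional set, so a
  disjoint countable subfamily covers almost all of it.  Any finite part of this subfamily is a fine
  partial division on which the error exceeds \<open>\<mu>\<close> times the length; its total length is thus at
  most \<open>e\<close>, and \<open>e\<close> is arbitrary.\<close>

lemma negligible_proportional_integral_error:
  fixes f :: "real \<Rightarrow> real"
  assumes f: "f integrable_on {a..b}" and "\<mu> > 0"
  shows "negligible {t \<in> {a..b}. \<forall>\<delta>>0. \<exists>u v. a \<le> u \<and> u \<le> t \<and> t \<le> v \<and> v \<le> b \<and> u < v \<and> v - u < \<delta> \<and>
           \<mu> * (v - u) < \<bar>f t * (v - u) - integral {u..v} f\<bar>}" (is "negligible ?E")
  unfolding negligible_outer_le
proof (intro allI impI)
  fix e :: real assume "e > 0"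
  obtain \<gamma> where "gauge \<gamma>" and \<gamma>:
    "\<And>p. \<lbrakk>p tagged_partial_division_of (cbox a b); \<gamma> fine p\<rbrakk> \<Longrightarrow>
             sum (\<lambda>(x,k). norm(measure lborel k *\<^sub>R f x - integral k f)) p < \<mu> * e"
    using Henstock_lemma[of f a b "\<mu> * e"] f \<open>e > 0\<close> \<open>\<mu> > 0\<close> by auto
  \<comment> \<open>The intervals are indexed together with their tags; \<open>c\<close> and \<open>r\<close> are centre and radius, since
    the covering theorem speaks of balls.\<close>
  define K where "K = {(x,u,v). a \<le> u \<and> u \<le> x \<and> x \<le> v \<and> v \<le> b \<and> u < v \<and> {u..v} \<subseteq> \<gamma> x \<and>
           \<mu> * (v - u) < \<bar>f x * (v - u) - integral {u..v} f\<bar>}"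
  define c where "c = (\<lambda>(x::real,u,v). (u + v) / 2 :: real)"
  define r where "r = (\<lambda>(x::real,u,v). (v - u) / 2 :: real)"
  have cb: "cball (c (x,u,v)) (r (x,u,v)) = {u..v}" for x u v
    by (auto simp: c_def r_def dist_real_def abs_if field_simps split: if_splits)
  have r0: "0 < r i" if "i \<in> K" for i
    using that by (auto simp: K_def r_def)
  have cov: "\<exists>i. i \<in> K \<and> x \<in> cball (c i) (r i) \<and> r i < d" if x: "x \<in> ?E" and "0 < d" for x d
  proof -
    obtain \<eta> where "\<eta> > 0" and \<eta>: "ball x \<eta> \<subseteq> \<gamma> x"
      using \<open>gauge \<gamma>\<close> by (meson gauge_def open_contains_ball)
    then have "min \<eta> d > 0" using \<open>0 < d\<close> by auto
    with x obtain u v where uv: "a \<le> u" "u \<le> x" "x \<le> v" "v \<le> b" "u < v" "v - u < min \<eta> d"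
      "\<mu> * (v - u) < \<bar>f x * (v - u) - integral {u..v} f\<bar>" by blast
    moreover have "{u..v} \<subseteq> \<gamma> x"
      using uv by (intro order_trans[OF _ \<eta>]) (auto simp: dist_real_def)
    ultimately have "(x,u,v) \<in> K" by (auto simp: K_def)
    moreover have "x \<in> cball (c (x,u,v)) (r (x,u,v))" unfolding cb using uv by auto
    moreover have "r (x,u,v) < d" using uv by (auto simp: r_def)
    ultimately show ?thesis by blast
  qed
  obtain C where C: "countable C" "C \<subseteq> K"
     "pairwise (\<lambda>i j. disjnt (cball (c i) (r i)) (cball (c j) (r j))) C"
     "negligible (?E - (\<Union>i \<in> C. cball (c i) (r i)))"
    using Vitali_covering_theorem_cballs[of K r ?E c, OF r0 cov] by blast
  have bound: "measure lebesgue (\<Union>i\<in>D. cball (c i) (r i)) \<le> e" if D: "D \<subseteq> C" "finite D" for D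
  proof -
    define h where "h = (\<lambda>(x::real,u::real,v). (x, {u..v}))"
    have DK: "D \<subseteq> K" using D(1) C(2) by (rule order_trans)
    have disj: "{u..v} \<inter> {u'..v'} = {}"
      if "(x,u,v) \<in> D" "(x',u',v') \<in> D" "(x,u,v) \<noteq> (x',u',v')" for x u v x' u' v'
    proof -
      have "(x,u,v) \<in> C" "(x',u',v') \<in> C" using that D(1) by blast+
      from pairwiseD[OF C(3) this that(3)] show ?thesis unfolding cb disjnt_def .
    qed
    have inj: "inj_on h D"
    proof (rule inj_onI)
      fix i j assume ij: "i \<in> D" "j \<in> D" "h i = h j"
      obtain x u v x' u' v' where eq: "i = (x,u,v)" "j = (x',u',v')" by (metis prod_cases3)
      have "u < v" using ij(1) DK by (auto simp: eq K_def)
      then show "i = j" using disj[of x u v x' u' v'] ij unfolding eq h_def by auto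
    qed
    have part: "h ` D tagged_partial_division_of cbox a b"
      unfolding tagged_partial_division_of_def
    proof (intro conjI allI impI)
      show "finite (h ` D)" using D by auto
    next
      fix x k assume "(x,k) \<in> h ` D"
      then obtain u v where "(x,u,v) \<in> K" and k: "k = {u..v}"
        using DK by (auto simp: h_def)
      then show "x \<in> k" "k \<subseteq> cbox a b"
        by (auto simp: K_def)
      show "\<exists>a b. k = cbox a b"
        unfolding k by (metis box_real(2))
    next
      fix x1 k1 x2 k2 assume *: "(x1,k1) \<in> h ` D \<and> (x2,k2) \<in> h ` D \<and> (x1,k1) \<noteq> (x2,k2)"
      then obtain u v u' v' where "(x1,u,v) \<in> D" "(x2,u',v') \<in> D" "k1 = {u..v}" "k2 = {u'..v'}"
        by (auto simp: h_def)
      with * disj[of x1 u v x2 u' v'] have "k1 \<inter> k2 = {}" by auto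
      then show "interior k1 \<inter> interior k2 = {}"
        by (meson disjoint_iff interior_subset subsetD)
    qed
    have fine: "\<gamma> fine (h ` D)"
      using DK by (auto simp: fine_def h_def K_def)
    have "\<mu> * measure lebesgue (\<Union>i\<in>D. cball (c i) (r i)) \<le> \<mu> * (\<Sum>i\<in>D. measure lebesgue (cball (c i) (r i)))"
      using \<open>\<mu> > 0\<close> D by (intro mult_left_mono measure_UNION_le) auto
    also have "\<dots> = (\<Sum>i\<in>D. \<mu> * measure lebesgue (cball (c i) (r i)))"
      by (simp add: sum_distrib_left)
    also have "\<dots> \<le> (\<Sum>i\<in>D. (\<lambda>(x,k). norm(measure lborel k *\<^sub>R f x - integral k f)) (h i))"
    proof (rule sum_mono)
      fix i assume "i \<in> D"
      obtain x u v where i: "i = (x,u,v)" by (metis prod_cases3)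
      have "(x,u,v) \<in> K" using \<open>i \<in> D\<close> DK i by auto
      then show "\<mu> * measure lebesgue (cball (c i) (r i)) \<le> (\<lambda>(x,k). norm(measure lborel k *\<^sub>R f x - integral k f)) (h i)"
        unfolding i cb by (auto simp: K_def h_def mult.commute)
    qed
    also have "\<dots> = sum (\<lambda>(x,k). norm(measure lborel k *\<^sub>R f x - integral k f)) (h ` D)"
      by (simp add: sum.reindex[OF inj])
    also have "\<dots> < \<mu> * e"
      by (rule \<gamma>[OF part fine])
    finally show ?thesis using \<open>\<mu> > 0\<close> by simp
  qed
  let ?U = "\<Union>i \<in> C. cball (c i) (r i)"
  have U: "?U \<in> lmeasurable" "measure lebesgue ?U \<le> e"
    using fmeasurable_UN_bound[OF C(1), of "\<lambda>i. cball (c i) (r i)" lebesgue e]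
      measure_UN_bound[OF C(1), of "\<lambda>i. cball (c i) (r i)" lebesgue e] bound by auto
  have "?E \<subseteq> ?U \<union> (?E - ?U)" by blast
  moreover have "?U \<union> (?E - ?U) \<in> lmeasurable"
    by (rule fmeasurable.Un[OF U(1) negligible_imp_measurable[OF C(4)]])
  moreover have "measure lebesgue (?U \<union> (?E - ?U)) \<le> e"
  proof -
    have "measure lebesgue (?U \<union> (?E - ?U)) = measure lebesgue ?U"
      by (rule measure_Un_null_set) (use U(1) C(4) in \<open>simp_all only: negligible_iff_null_sets fmeasurableD\<close>)
    with U(2) show ?thesis by simp
  qed
  ultimately show "\<exists>T. ?E \<subseteq> T \<and> T \<in> lmeasurable \<and> measure lebesgue T \<le> e" by blast
qed

lemma integral_diff_interval:
  fixes f :: "real \<Rightarrow> real"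
  assumes "f integrable_on {a..b}" "a \<le> u" "u \<le> v" "v \<le> b"
  shows "integral {a..v} f - integral {a..u} f = integral {u..v} f"
proof -
  have "f integrable_on {a..v}" using assms by (auto intro: integrable_subinterval_real)
  then show ?thesis using Henstock_Kurzweil_Integration.integral_combine[of a u v f] assms by simp
qed

text \<open>
  Away from the null sets of \<open>negligible_proportional_integral_error\<close> for \<open>\<mu> = 1, 1/2, 1/3, \<dots>\<close>, the integral over a short
  interval with end point \<open>t\<close> differs from \<open>f t\<close> times the length by an arbitrarily small multiple of
  the length, which is differentiability of the indefinite integral.\<close>

lemma lebesgue_differentiation_interval:
  fixes f :: "real \<Rightarrow> real"
  assumes f: "f integrable_on {a..b}"
  shows "\<exists>N. negligible N \<and>
    (\<forall>t\<in>{a..b} - N. ((\<lambda>t. integral {a..t} f) has_real_derivative f t) (at t within {a..b}))"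
proof -
  define E where "E \<mu> = {t \<in> {a..b}. \<forall>\<delta>>0. \<exists>u v. a \<le> u \<and> u \<le> t \<and> t \<le> v \<and> v \<le> b \<and> u < v \<and> v - u < \<delta> \<and>
           \<mu> * (v - u) < \<bar>f t * (v - u) - integral {u..v} f\<bar>}" for \<mu>
  let ?N = "\<Union>n::nat. E (1 / Suc n)"
  have "negligible ?N"
  proof (intro negligible_countable_Union countable_image)
    show "negligible S" if "S \<in> range (\<lambda>n. E (1 / Suc n))" for S
      using that negligible_proportional_integral_error[OF f, of "1 / Suc n" for n] unfolding E_def by fastforce
  qed simp
  moreover have "((\<lambda>t. integral {a..t} f) has_real_derivative f t) (at t within {a..b})"
    if t: "t \<in> {a..b} - ?N" for t
    unfolding has_field_derivative_def has_derivative_within_alt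
  proof (intro conjI allI impI bounded_linear_mult_right)
    fix e :: real assume "e > 0"
    then obtain n where n: "1 / Suc n < e"
      using nat_approx_posE by metis
    have "t \<notin> E (1 / Suc n)" using t by blast
    then obtain \<delta> where "\<delta> > 0" and \<delta>: "\<And>u v. \<lbrakk>a \<le> u; u \<le> t; t \<le> v; v \<le> b; u < v; v - u < \<delta>\<rbrakk> \<Longrightarrow>
       \<bar>f t * (v - u) - integral {u..v} f\<bar> \<le> 1 / Suc n * (v - u)"
      using t unfolding E_def by (simp only: mem_Collect_eq Diff_iff not_all not_ex not_imp de_Morgan_conj not_less)
        (meson not_less)
    have \<delta>e: "\<bar>f t * (v - u) - integral {u..v} f\<bar> \<le> e * (v - u)" 
      if "a \<le> u" "u \<le> t" "t \<le> v" "v \<le> b" "u < v" "v - u < \<delta>" for u v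
      using \<delta>[OF that] n that by (smt (verit) mult_right_mono)
    have "norm (integral {a..y} f - integral {a..t} f - f t * (y - t)) \<le> e * norm (y - t)"
      if "y \<in> {a..b}" "norm (y - t) < \<delta>" for y
    proof (cases y t rule: linorder_cases)
      case less
      then show ?thesis using \<delta>e[of y t] integral_diff_interval[OF f, of y t] t that
        by (auto simp: abs_minus_commute algebra_simps)
    next
      case greater
      then show ?thesis using \<delta>e[of t y] integral_diff_interval[OF f, of t y] t that
        by (auto simp: abs_minus_commute algebra_simps)
    qed auto
    then show "\<exists>d>0. \<forall>y\<in>{a..b}. norm (y - t) < d \<longrightarrow>
      norm (integral {a..y} f - integral {a..t} f - f t * (y - t)) \<le> e * norm (y - t)"
      using \<open>\<delta> > 0\<close> by blast
  qed
  ultimately show ?thesis by blast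
qed

section \<open>Absolutely continuous functions\<close>

text \<open>
  Families of intervals indexed by any finite set are used below, notably the tagged intervals of a
  division, which are indexed by themselves.\<close>

lemma absolutely_continuous_on_finite_index:
  assumes "absolutely_continuous_on S f" "\<epsilon> > 0"
  shows "\<exists>\<delta>>0. \<forall>(I :: 'i set) u v. finite I \<longrightarrow> (\<forall>i\<in>I. u i \<le> v i \<and> {u i..v i} \<subseteq> S) \<longrightarrow>
       disjoint_family_on (\<lambda>i. {u i<..<v i}) I \<longrightarrow> (\<Sum>i\<in>I. v i - u i) < \<delta> \<longrightarrow>
       (\<Sum>i\<in>I. \<bar>f (v i) - f (u i)\<bar>) < \<epsilon>"
proof -
  obtain \<delta> where "\<delta> > 0" and all: "\<forall>(n::nat) u v. (\<forall>i<n. u i \<le> v i \<and> {u i..v i} \<subseteq> S) \<and>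
      disjoint_family_on (\<lambda>i. {u i<..<v i}) {..<n} \<and> (\<Sum>i<n. v i - u i) < \<delta>
      \<longrightarrow> (\<Sum>i<n. \<bar>f (v i) - f (u i)\<bar>) < \<epsilon>"
    using assms(1)[unfolded absolutely_continuous_on_def, THEN spec, THEN mp, OF assms(2)] by (elim exE conjE)
  have \<delta>: "(\<Sum>i<n. \<bar>f (v i) - f (u i)\<bar>) < \<epsilon>"
    if "\<forall>i<n. u i \<le> v i \<and> {u i..v i} \<subseteq> S" "disjoint_family_on (\<lambda>i. {u i<..<v i}) {..<n}"
      "(\<Sum>i<n. v i - u i) < \<delta>" for n :: nat and u v
    using that by (intro all[THEN spec, THEN spec, THEN spec, THEN mp] conjI)
  show ?thesis
  proof (intro exI[of _ \<delta>] conjI \<open>\<delta> > 0\<close> allI impI)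
    fix I :: "'i set" and u v
    assume I: "finite I" "\<forall>i\<in>I. u i \<le> v i \<and> {u i..v i} \<subseteq> S"
       "disjoint_family_on (\<lambda>i. {u i<..<v i}) I" "(\<Sum>i\<in>I. v i - u i) < \<delta>"
    obtain h where h: "bij_betw h {..<card I} I"
      using ex_bij_betw_nat_finite[OF I(1)] atLeast0LessThan by metis
    have "(\<Sum>i<card I. \<bar>f (v (h i)) - f (u (h i))\<bar>) < \<epsilon>"
    proof (rule \<delta>)
      show "\<forall>i<card I. u (h i) \<le> v (h i) \<and> {u (h i)..v (h i)} \<subseteq> S"
        using I(2) bij_betwE[OF h] by blast
      show "disjoint_family_on (\<lambda>i. {u (h i)<..<v (h i)}) {..<card I}"
        unfolding disjoint_family_on_def
      proof (intro ballI impI)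
        fix m n assume "m \<in> {..<card I}" "n \<in> {..<card I}" "m \<noteq> n"
        then have "h m \<in> I" "h n \<in> I" "h m \<noteq> h n"
          using bij_betwE[OF h] bij_betw_imp_inj_on[OF h] by (auto dest: inj_onD)
        then show "{u (h m)<..<v (h m)} \<inter> {u (h n)<..<v (h n)} = {}"
          using I(3) unfolding disjoint_family_on_def by blast
      qed
      show "(\<Sum>i<card I. v (h i) - u (h i)) < \<delta>"
        using I(4) by (simp add: sum.reindex_bij_betw[OF h, of "\<lambda>i. v i - u i"])
    qed
    then show "(\<Sum>i\<in>I. \<bar>f (v i) - f (u i)\<bar>) < \<epsilon>"
      by (simp add: sum.reindex_bij_betw[OF h, of "\<lambda>i. \<bar>f (v i) - f (u i)\<bar>"])
  qed
qed

lemma absolutely_continuous_on_subset: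
  assumes "absolutely_continuous_on S f" "T \<subseteq> S"
  shows "absolutely_continuous_on T f"
  unfolding absolutely_continuous_on_def
proof (intro allI impI)
  fix \<epsilon> :: real assume "\<epsilon> > 0"
  obtain \<delta> where \<delta>: "\<delta> > 0" "\<forall>(I :: nat set) u v. finite I \<longrightarrow> (\<forall>i\<in>I. u i \<le> v i \<and> {u i..v i} \<subseteq> S) \<longrightarrow>
       disjoint_family_on (\<lambda>i. {u i<..<v i}) I \<longrightarrow> (\<Sum>i\<in>I. v i - u i) < \<delta> \<longrightarrow>
        (\<Sum>i\<in>I. \<bar>f (v i) - f (u i)\<bar>) < \<epsilon>"
    using absolutely_continuous_on_finite_index[OF assms(1) \<open>\<epsilon> > 0\<close>] by (elim exE conjE)
  show "\<exists>\<delta>>0. \<forall>(n::nat) u v. (\<forall>i<n. u i \<le> v i \<and> {u i..v i} \<subseteq> T) \<and>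
      disjoint_family_on (\<lambda>i. {u i<..<v i}) {..<n} \<and> (\<Sum>i<n. v i - u i) < \<delta>
      \<longrightarrow> (\<Sum>i<n. \<bar>f (v i) - f (u i)\<bar>) < \<epsilon>"
    using assms(2) by (intro exI[of _ \<delta>] conjI \<delta>(1) allI impI \<delta>(2)[rule_format]) auto
qed

text \<open>
  One estimate on increments covers all closure properties that are needed: differences, compositions
  with Lipschitz functions, and addition of constants.\<close>

lemma absolutely_continuous_on_dominated:
  assumes f: "absolutely_continuous_on S f" and g: "absolutely_continuous_on S g"
    and dom: "\<And>u v. \<lbrakk>u \<in> S; v \<in> S\<rbrakk> \<Longrightarrow> \<bar>w v - w u\<bar> \<le> C * \<bar>f v - f u\<bar> + D * \<bar>g v - g u\<bar>"
    and C: "C > 0" and D: "D > 0"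
  shows "absolutely_continuous_on S w"
  unfolding absolutely_continuous_on_def
proof (intro allI impI)
  fix \<epsilon> :: real assume "\<epsilon> > 0"
  then have "\<epsilon> / (2 * C) > 0" "\<epsilon> / (2 * D) > 0" using C D by auto
  obtain \<delta>1 where \<delta>1: "\<delta>1 > 0" "\<forall>(I :: nat set) u v. finite I \<longrightarrow> (\<forall>i\<in>I. u i \<le> v i \<and> {u i..v i} \<subseteq> S) \<longrightarrow>
       disjoint_family_on (\<lambda>i. {u i<..<v i}) I \<longrightarrow> (\<Sum>i\<in>I. v i - u i) < \<delta>1 \<longrightarrow>
        (\<Sum>i\<in>I. \<bar>f (v i) - f (u i)\<bar>) < \<epsilon> / (2 * C)"
    using absolutely_continuous_on_finite_index[OF f \<open>\<epsilon> / (2 * C) > 0\<close>] by (elim exE conjE)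
  obtain \<delta>2 where \<delta>2: "\<delta>2 > 0" "\<forall>(I :: nat set) u v. finite I \<longrightarrow> (\<forall>i\<in>I. u i \<le> v i \<and> {u i..v i} \<subseteq> S) \<longrightarrow>
       disjoint_family_on (\<lambda>i. {u i<..<v i}) I \<longrightarrow> (\<Sum>i\<in>I. v i - u i) < \<delta>2 \<longrightarrow>
        (\<Sum>i\<in>I. \<bar>g (v i) - g (u i)\<bar>) < \<epsilon> / (2 * D)"
    using absolutely_continuous_on_finite_index[OF g \<open>\<epsilon> / (2 * D) > 0\<close>] by (elim exE conjE)
  have "(\<Sum>i<n. \<bar>w (v i) - w (u i)\<bar>) < \<epsilon>"
    if uv: "\<forall>i<n. u i \<le> v i \<and> {u i..v i} \<subseteq> S" "disjoint_family_on (\<lambda>i. {u i<..<v i}) {..<n}"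
       "(\<Sum>i<n. v i - u i) < min \<delta>1 \<delta>2" for n :: nat and u v
  proof -
    have "(\<Sum>i<n. \<bar>w (v i) - w (u i)\<bar>) \<le> (\<Sum>i<n. C * \<bar>f (v i) - f (u i)\<bar> + D * \<bar>g (v i) - g (u i)\<bar>)"
    proof (rule sum_mono)
      fix i assume "i \<in> {..<n}"
      then have "u i \<in> S" "v i \<in> S" using uv(1) by force+
      then show "\<bar>w (v i) - w (u i)\<bar> \<le> C * \<bar>f (v i) - f (u i)\<bar> + D * \<bar>g (v i) - g (u i)\<bar>"
        by (rule dom)
    qed
    also have "\<dots> = C * (\<Sum>i<n. \<bar>f (v i) - f (u i)\<bar>) + D * (\<Sum>i<n. \<bar>g (v i) - g (u i)\<bar>)"
      by (simp add: sum.distrib sum_distrib_left)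
    also have "\<dots> < C * (\<epsilon> / (2 * C)) + D * (\<epsilon> / (2 * D))"
      using uv C D by (intro add_strict_mono mult_strict_left_mono \<delta>1(2)[rule_format] \<delta>2(2)[rule_format]) auto
    also have "\<dots> = \<epsilon>" using C D by (simp add: field_simps)
    finally show ?thesis .
  qed
  then show "\<exists>\<delta>>0. \<forall>(n::nat) u v. (\<forall>i<n. u i \<le> v i \<and> {u i..v i} \<subseteq> S) \<and>
      disjoint_family_on (\<lambda>i. {u i<..<v i}) {..<n} \<and> (\<Sum>i<n. v i - u i) < \<delta>
      \<longrightarrow> (\<Sum>i<n. \<bar>w (v i) - w (u i)\<bar>) < \<epsilon>"
    using \<delta>1(1) \<delta>2(1) by (intro exI[of _ "min \<delta>1 \<delta>2"]) auto
qed

lemma absolutely_continuous_on_diff: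
  assumes "absolutely_continuous_on S f" "absolutely_continuous_on S g"
  shows "absolutely_continuous_on S (\<lambda>t. f t - g t)"
  by (rule absolutely_continuous_on_dominated[OF assms, where C = 1 and D = 1]) auto

lemma absolutely_continuous_on_lipschitz_compose:
  assumes "absolutely_continuous_on S f" "C > 0"
    "\<And>u v. \<lbrakk>u \<in> S; v \<in> S\<rbrakk> \<Longrightarrow> \<bar>\<phi> (f v) - \<phi> (f u)\<bar> \<le> C * \<bar>f v - f u\<bar>"
  shows "absolutely_continuous_on S (\<lambda>t. \<phi> (f t))"
proof (rule absolutely_continuous_on_dominated[OF assms(1) assms(1), where C = C and D = 1])
  show "\<bar>\<phi> (f v) - \<phi> (f u)\<bar> \<le> C * \<bar>f v - f u\<bar> + 1 * \<bar>f v - f u\<bar>" if "u \<in> S" "v \<in> S" for u v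
    using assms(3)[OF that] by simp
qed (use assms in auto)

lemma absolutely_continuous_on_imp_continuous_on:
  assumes "absolutely_continuous_on {a..b} f"
  shows "continuous_on {a..b} f"
  unfolding continuous_on_iff
proof (intro ballI allI impI)
  fix s e :: real assume s: "s \<in> {a..b}" and "e > 0"
  obtain \<delta> where \<delta>: "\<delta> > 0" "\<forall>(I :: unit set) u v. finite I \<longrightarrow> (\<forall>i\<in>I. u i \<le> v i \<and> {u i..v i} \<subseteq> {a..b}) \<longrightarrow>
       disjoint_family_on (\<lambda>i. {u i<..<v i}) I \<longrightarrow> (\<Sum>i\<in>I. v i - u i) < \<delta> \<longrightarrow>
        (\<Sum>i\<in>I. \<bar>f (v i) - f (u i)\<bar>) < e"
    using absolutely_continuous_on_finite_index[OF assms \<open>e > 0\<close>] by (elim exE conjE)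
  have "dist (f t) (f s) < e" if "t \<in> {a..b}" "dist t s < \<delta>" for t
    using \<delta>(2)[rule_format, of "{()}" "\<lambda>_. min s t" "\<lambda>_. max s t"] that s
    by (cases "s \<le> t") (auto simp: disjoint_family_on_def dist_real_def abs_minus_commute)
  then show "\<exists>d>0. \<forall>t\<in>{a..b}. dist t s < d \<longrightarrow> dist (f t) (f s) < e"
    using \<delta>(1) by blast
qed

text \<open>
  Cousin's lemma reduces the increment over \<open>[a,b]\<close> to increments over the intervals of a fine
  tagged division.  The gauge is chosen so that an interval tagged outside \<open>N\<close> has an increment of
  at least \<open>- e1\<close> times its length, by differentiability at the tag, and so that an interval tagged in
  \<open>N\<close> lies in an open set \<open>T\<close> of small measure; absolute continuity bounds the total increment over
  the latter.\<close>

lemma absolutely_continuous_nonneg_derivative_imp_le: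
  fixes w :: "real \<Rightarrow> real"
  assumes ac: "absolutely_continuous_on {a..b} w" and "a \<le> b" and N: "negligible N"
    and der: "\<And>t. t \<in> {a..b} - N \<Longrightarrow> \<exists>D\<ge>0. (w has_real_derivative D) (at t within {a..b})"
  shows "w a \<le> w b"
proof (rule field_le_epsilon)
  fix e :: real assume "e > 0"
  \<comment> \<open>The extra \<open>1\<close> in the denominator keeps \<open>e1\<close> meaningful when \<open>a = b\<close>.\<close>
  define e1 where "e1 = e / (2 * (b - a + 1))"
  have e1: "e1 > 0" "e1 * (b - a) \<le> e / 2"
    using \<open>e > 0\<close> \<open>a \<le> b\<close> by (auto simp: e1_def field_simps)
  obtain \<delta> where \<delta>: "\<delta> > 0" "\<forall>(I :: (real \<times> real set) set) u v. finite I \<longrightarrow> (\<forall>i\<in>I. u i \<le> v i \<and> {u i..v i} \<subseteq> {a..b}) \<longrightarrow>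
       disjoint_family_on (\<lambda>i. {u i<..<v i}) I \<longrightarrow> (\<Sum>i\<in>I. v i - u i) < \<delta> \<longrightarrow>
        (\<Sum>i\<in>I. \<bar>w (v i) - w (u i)\<bar>) < e / 2"
    using absolutely_continuous_on_finite_index[OF ac half_gt_zero[OF \<open>e > 0\<close>]] by (elim exE conjE)
  have Ns: "N \<in> sets lebesgue" using N by (simp add: negligible_imp_sets)
  obtain T where T: "open T" "N \<subseteq> T" "(T - N) \<in> lmeasurable" "emeasure lebesgue (T - N) < ennreal \<delta>"
    using sets_lebesgue_outer_open[OF Ns \<delta>(1)] by blast
  have TN: "T = (T - N) \<union> N" using T(2) by blast
  have Tm: "T \<in> lmeasurable"
    using fmeasurable.Un[OF T(3) negligible_imp_measurable[OF N]] TN by simp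
  have "measure lebesgue T = measure lebesgue (T - N)"
    using N Ns Tm by (simp add: measure_Diff_null_set negligible_iff_null_sets fmeasurableD)
  also have "\<dots> < \<delta>"
    using T(3,4) \<delta>(1) by (simp add: emeasure_eq_measure2 ennreal_less_iff)
  finally have T\<delta>: "measure lebesgue T < \<delta>" .
  have "\<exists>d>0. \<forall>u v. a \<le> u \<longrightarrow> u \<le> t \<longrightarrow> t \<le> v \<longrightarrow> v \<le> b \<longrightarrow> {u..v} \<subseteq> ball t d \<longrightarrow> - e1 * (v - u) \<le> w v - w u"
    if t: "t \<in> {a..b} - N" for t
  proof -
    obtain D where D: "D \<ge> 0" "(w has_real_derivative D) (at t within {a..b})" using der[OF t] by blast
    then obtain d where "d > 0" and d: "\<And>y. y \<in> {a..b} \<Longrightarrow> norm (y - t) < d \<Longrightarrow>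
        norm (w y - w t - D * (y - t)) \<le> e1 * norm (y - t)"
      using e1(1) unfolding has_field_derivative_def has_derivative_within_alt by blast
    have "- e1 * (v - u) \<le> w v - w u" if "a \<le> u" "u \<le> t" "t \<le> v" "v \<le> b" "{u..v} \<subseteq> ball t d" for u v
    proof -
      have *: "u \<in> ball t d" "v \<in> ball t d"
        by (rule subsetD[OF that(5)], use that in simp)+
      have "0 \<le> D * (v - t)" "0 \<le> D * (t - u)" using D that by auto
      moreover have "norm (w v - w t - D * (v - t)) \<le> e1 * norm (v - t)"
        using that * by (intro d) (auto simp: dist_real_def)
      moreover have "norm (w u - w t - D * (u - t)) \<le> e1 * norm (u - t)"
        using that * by (intro d) (auto simp: dist_real_def)
      ultimately show ?thesis using that by (auto simp: abs_le_iff algebra_simps)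
    qed
    with \<open>d > 0\<close> show ?thesis by blast
  qed
  then obtain d where d: "\<And>t. t \<in> {a..b} - N \<Longrightarrow> d t > 0" "\<And>t u v. t \<in> {a..b} - N \<Longrightarrow>
      a \<le> u \<Longrightarrow> u \<le> t \<Longrightarrow> t \<le> v \<Longrightarrow> v \<le> b \<Longrightarrow> {u..v} \<subseteq> ball t (d t) \<Longrightarrow> - e1 * (v - u) \<le> w v - w u"
    by metis
  define \<gamma> where "\<gamma> t = (if t \<in> N then T else if t \<in> {a..b} then ball t (d t) else UNIV)" for t
  have "gauge \<gamma>"
    using T(1,2) d(1) by (auto simp: gauge_def \<gamma>_def)
  then obtain p where p: "p tagged_division_of {a..b}" "\<gamma> fine p"
    by (rule fine_division_exists_real)
  have pk: "\<exists>u v. k = {u..v} \<and> u \<le> x \<and> x \<le> v \<and> a \<le> u \<and> v \<le> b \<and> Inf k = u \<and> Sup k = v \<and> {u..v} \<subseteq> \<gamma> x"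
    if xk: "(x,k) \<in> p" for x k
  proof -
    obtain u v where k: "k = cbox u v" using tagged_division_ofD(4)[OF p(1) xk] by blast
    have "x \<in> k" "k \<subseteq> {a..b}" using tagged_division_ofD(2,3)[OF p(1) xk] by auto
    moreover have "k \<subseteq> \<gamma> x" using p(2) xk by (auto simp: fine_def)
    ultimately show ?thesis unfolding k by (intro exI[of _ u] exI[of _ v]) auto
  qed
  have fin: "finite p" using p(1) by blast
  \<comment> \<open>The part of the division that is tagged in the null set; \<open>l\<close> and \<open>r\<close> are the end points.\<close>
  define q where "q = {i \<in> p. fst i \<in> N}"
  define l where "l i = Inf (snd i)" for i :: "real \<times> real set"
  define r where "r i = Sup (snd i)" for i :: "real \<times> real set"
  have lr: "l i \<le> r i \<and> {l i..r i} \<subseteq> {a..b} \<and> snd i = {l i..r i} \<and> {l i..r i} \<subseteq> \<gamma> (fst i)"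
    if "i \<in> p" for i
  proof -
    have "(fst i, snd i) \<in> p" using that by simp
    from pk[OF this] obtain u v where uv: "snd i = {u..v}" "u \<le> fst i" "fst i \<le> v" "a \<le> u" "v \<le> b"
        "Inf (snd i) = u" "Sup (snd i) = v" "{u..v} \<subseteq> \<gamma> (fst i)"
      by (elim exE conjE)
    then have "l i = u" "r i = v" by (simp_all only: l_def r_def)
    with uv show ?thesis by auto
  qed
  have lrT: "{l i<..<r i} \<subseteq> T" if "i \<in> q" for i
  proof -
    have "{l i<..<r i} \<subseteq> {l i..r i}" by auto
    also have "\<dots> \<subseteq> T" using lr[of i] that by (auto simp: q_def \<gamma>_def)
    finally show ?thesis .
  qed
  have disj: "disjoint_family_on (\<lambda>i. {l i<..<r i}) q"
    unfolding disjoint_family_on_def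
  proof (intro ballI impI)
    fix i j assume ij: "i \<in> q" "j \<in> q" "i \<noteq> j"
    then have "interior (snd i) \<inter> interior (snd j) = {}"
      using tagged_division_ofD(5)[OF p(1), of "fst i" "snd i" "fst j" "snd j"] by (auto simp: q_def)
    then show "{l i<..<r i} \<inter> {l j<..<r j} = {}"
      using lr[of i] lr[of j] ij by (auto simp: q_def)
  qed
  have "(\<Sum>i\<in>q. r i - l i) = (\<Sum>i\<in>q. measure lebesgue {l i<..<r i})"
    using lr by (intro sum.cong) (auto simp: q_def)
  also have "\<dots> = measure lebesgue (\<Union>i\<in>q. {l i<..<r i})"
    using fin disj lr by (intro measure_finite_Union[symmetric]) (auto simp: q_def)
  also have "\<dots> \<le> measure lebesgue T"
    using lrT fin Tm by (intro measure_mono_fmeasurable) (auto simp: q_def)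
  also note T\<delta>
  finally have "(\<Sum>i\<in>q. \<bar>w (r i) - w (l i)\<bar>) < e / 2"
    using lr fin by (intro \<delta>(2)[rule_format] disj) (auto simp: q_def)
  moreover have "\<bar>\<Sum>i\<in>q. w (r i) - w (l i)\<bar> \<le> (\<Sum>i\<in>q. \<bar>w (r i) - w (l i)\<bar>)" by (rule sum_abs)
  ultimately have qb: "- (e / 2) \<le> (\<Sum>i\<in>q. w (r i) - w (l i))" by linarith
  \<comment> \<open>The lengths add up to \<open>b - a\<close>, and dropping the intervals in \<open>q\<close> only raises a sum of nonpositive terms.\<close>
  have "- e1 * (b - a) = - e1 * (\<Sum>i\<in>p. r i - l i)"
    using additive_tagged_division_1[OF \<open>a \<le> b\<close> p(1), of "\<lambda>x. x"] by (simp add: l_def r_def case_prod_unfold)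
  also have "\<dots> \<le> - e1 * (\<Sum>i\<in>p - q. r i - l i)"
    using lr fin e1(1) by (simp add: q_def) (intro sum_mono2; auto)
  also have "\<dots> = (\<Sum>i\<in>p - q. - e1 * (r i - l i))" by (rule sum_distrib_left)
  also have "\<dots> \<le> (\<Sum>i\<in>p - q. w (r i) - w (l i))"
  proof (rule sum_mono)
    fix i assume i: "i \<in> p - q"
    then have "(fst i, snd i) \<in> p" by simp
    from pk[OF this] obtain u v where uv: "u \<le> fst i" "fst i \<le> v" "a \<le> u" "v \<le> b" "l i = u" "r i = v"
      "{u..v} \<subseteq> \<gamma> (fst i)"
      unfolding l_def r_def by (elim exE conjE)
    then have "fst i \<in> {a..b} - N" using i by (auto simp: q_def)
    then show "- e1 * (r i - l i) \<le> w (r i) - w (l i)"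
      using uv d(2)[of "fst i" u v] by (auto simp: \<gamma>_def)
  qed
  finally have "- (e / 2) \<le> (\<Sum>i\<in>p - q. w (r i) - w (l i))" using e1(2) by linarith
  moreover have "w b - w a = (\<Sum>i\<in>p. w (r i) - w (l i))"
    using additive_tagged_division_1[OF \<open>a \<le> b\<close> p(1), of w] by (simp add: l_def r_def case_prod_unfold)
  moreover have "(\<Sum>i\<in>p. w (r i) - w (l i)) = (\<Sum>i\<in>p - q. w (r i) - w (l i)) + (\<Sum>i\<in>q. w (r i) - w (l i))"
    using fin by (intro sum.subset_diff) (auto simp: q_def)
  ultimately show "w a \<le> w b + e" using qb by linarith
qed

section \<open>The fundamental theorem of calculus for absolutely continuous functions\<close>

text \<open>
  The open intervals are disjoint, and passing to them changes no integral.\<close>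

lemma sum_integral_disjoint_le:
  fixes k :: "real \<Rightarrow> real"
  assumes k: "k integrable_on {a..b}" "\<And>t. t \<in> {a..b} \<Longrightarrow> 0 \<le> k t" and "finite I"
    and uv: "\<And>i. i \<in> I \<Longrightarrow> {u i..v i} \<subseteq> {a..b}"
    and disj: "disjoint_family_on (\<lambda>i. {u i<..<v i}) I"
  shows "(\<Sum>i\<in>I. integral {u i..v i} k) \<le> integral {a..b} k"
proof -
  have "(k has_integral (\<Sum>i\<in>I. integral {u i..v i} k)) (\<Union>i\<in>I. {u i<..<v i})"
  proof (rule has_integral_UN[OF \<open>finite I\<close>])
    fix i assume "i \<in> I"
    then have "k integrable_on {u i..v i}" using k(1) uv integrable_on_subinterval by blast
    then show "(k has_integral integral {u i..v i} k) {u i<..<v i}"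
      using has_integral_open_interval[of k "integral {u i..v i} k" "u i" "v i"]
      by (simp add: integrable_integral)
  next
    show "pairwise (\<lambda>i j. negligible ({u i<..<v i} \<inter> {u j<..<v j})) I"
      using disj unfolding pairwise_def disjoint_family_on_def by (metis negligible_empty)
  qed
  moreover have "(\<Union>i\<in>I. {u i<..<v i}) \<subseteq> {a..b}"
  proof (rule UN_least)
    fix i assume "i \<in> I"
    moreover have "{u i<..<v i} \<subseteq> {u i..v i}" by auto
    ultimately show "{u i<..<v i} \<subseteq> {a..b}" using uv by blast
  qed
  ultimately show ?thesis
    using k by (intro has_integral_subset_le[of "\<Union>i\<in>I. {u i<..<v i}" "{a..b}" k]) auto
qed

text \<open>
  Truncation: \<open>\<bar>f\<bar>\<close> is the sum of its excess \<open>k n\<close> above the height \<open>n\<close> and a function bounded by \<open>n\<close>.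
  By dominated convergence some excess has an integral below \<open>\<epsilon>/2\<close>; the bounded part contributes at most
  \<open>n\<close> times the total length.\<close>

lemma absolutely_continuous_on_integral:
  fixes f :: "real \<Rightarrow> real"
  assumes f: "f absolutely_integrable_on {a..b}"
  shows "absolutely_continuous_on {a..b} (\<lambda>t. integral {a..t} f)"
  unfolding absolutely_continuous_on_def
proof (intro allI impI)
  fix \<epsilon> :: real assume "\<epsilon> > 0"
  have fi: "f integrable_on {a..b}" "(\<lambda>t. \<bar>f t\<bar>) integrable_on {a..b}"
    using f by (auto simp: absolutely_integrable_on_def)
  define k where "k n t = \<bar>f t\<bar> - min \<bar>f t\<bar> (real n)" for n t
  have ki: "k n integrable_on {a..b}" for n
  proof (rule measurable_bounded_by_integrable_imp_integrable[OF _ fi(2)])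
    have "f \<in> borel_measurable (lebesgue_on {a..b})"
      using fi(1) by (rule integrable_imp_measurable)
    then show "k n \<in> borel_measurable (lebesgue_on {a..b})" unfolding k_def by measurable
  qed (auto simp: k_def)
  have "(\<lambda>n. integral {a..b} (k n)) \<longlonglongrightarrow> integral {a..b} (\<lambda>t. 0::real)"
  proof (rule dominated_convergence(2)[OF ki fi(2)])
    show "(\<lambda>n. k n t) \<longlonglongrightarrow> 0" for t
    proof (rule tendsto_eventually)
      show "\<forall>\<^sub>F n in sequentially. k n t = 0"
        using eventually_ge_at_top[of "nat \<lceil>\<bar>f t\<bar>\<rceil>"]
      proof eventually_elim
        case (elim n)
        then have "\<bar>f t\<bar> \<le> real n" by linarith
        then show ?case by (simp add: k_def)
      qed
    qed
  qed (auto simp: k_def)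
  then have "\<forall>\<^sub>F n in sequentially. integral {a..b} (k n) < \<epsilon> / 2"
    using \<open>\<epsilon> > 0\<close> by (intro order_tendstoD(2)[of _ 0]) auto
  then obtain n where n: "integral {a..b} (k n) < \<epsilon> / 2"
    by (auto simp: eventually_sequentially)
  have bound: "\<bar>integral {a..v} f - integral {a..u} f\<bar> \<le> integral {u..v} (k n) + real n * (v - u)"
    if uv: "u \<le> v" "{u..v} \<subseteq> {a..b}" for u v
  proof -
    have f_uv: "f integrable_on {u..v}" and k_uv: "k n integrable_on {u..v}"
      using integrable_on_subinterval fi(1) ki uv by blast+
    have "integral {a..v} f - integral {a..u} f = integral {u..v} f"
      using uv by (intro integral_diff_interval[OF fi(1)]) auto
    moreover have "norm (integral {u..v} f) \<le> integral {u..v} (\<lambda>t. k n t + real n)"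
      by (intro integral_norm_bound_integral f_uv integrable_add k_uv) (auto simp: k_def)
    moreover have "integral {u..v} (\<lambda>t. k n t + real n) = integral {u..v} (k n) + real n * (v - u)"
      using uv by (subst integral_add[OF k_uv]) (auto simp: mult.commute)
    ultimately show ?thesis by simp
  qed
  show "\<exists>\<delta>>0. \<forall>(n::nat) u v. (\<forall>i<n. u i \<le> v i \<and> {u i..v i} \<subseteq> {a..b}) \<and>
      disjoint_family_on (\<lambda>i. {u i<..<v i}) {..<n} \<and> (\<Sum>i<n. v i - u i) < \<delta>
      \<longrightarrow> (\<Sum>i<n. \<bar>integral {a..v i} f - integral {a..u i} f\<bar>) < \<epsilon>"
  proof (intro exI[of _ "\<epsilon> / (2 * (real n + 1))"] conjI allI impI, goal_cases)
    case 1
    then show ?case using \<open>\<epsilon> > 0\<close> by simp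
  next
    case (2 m u v)
    then have uv: "\<And>i. i < m \<Longrightarrow> u i \<le> v i \<and> {u i..v i} \<subseteq> {a..b}"
       and disj: "disjoint_family_on (\<lambda>i. {u i<..<v i}) {..<m}"
       and len: "(\<Sum>i<m. v i - u i) < \<epsilon> / (2 * (real n + 1))" by auto
    have "(\<Sum>i<m. \<bar>integral {a..v i} f - integral {a..u i} f\<bar>)
        \<le> (\<Sum>i<m. integral {u i..v i} (k n) + real n * (v i - u i))"
      using uv by (intro sum_mono bound) auto
    also have "\<dots> = (\<Sum>i<m. integral {u i..v i} (k n)) + real n * (\<Sum>i<m. v i - u i)"
      by (simp add: sum.distrib sum_distrib_left)
    also have "\<dots> \<le> integral {a..b} (k n) + real n * (\<Sum>i<m. v i - u i)"
      using uv by (intro add_right_mono sum_integral_disjoint_le ki disj) (auto simp: k_def)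
    also have "\<dots> < \<epsilon> / 2 + real n * (\<epsilon> / (2 * (real n + 1)))"
      using len by (intro add_less_le_mono n mult_left_mono) auto
    also have "\<dots> \<le> \<epsilon>" using \<open>\<epsilon> > 0\<close> by (simp add: field_simps)
    finally show ?case .
  qed
qed

lemma absolutely_continuous_zero_derivative_imp_const:
  fixes w :: "real \<Rightarrow> real"
  assumes ac: "absolutely_continuous_on {a..b} w" and N: "negligible N" and t: "t \<in> {a..b}"
    and der: "\<And>t. t \<in> {a..b} - N \<Longrightarrow> (w has_real_derivative 0) (at t within {a..b})"
  shows "w t = w a"
proof (rule antisym)
  have sub: "{a..t} \<subseteq> {a..b}" using t by auto
  note ac' = absolutely_continuous_on_subset[OF ac sub]
  have der': "(w has_real_derivative 0) (at s within {a..t})" if "s \<in> {a..t} - N" for s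
    using der[of s] that sub by (intro DERIV_subset[OF _ sub]) auto
  show "w a \<le> w t"
    using t der' by (intro absolutely_continuous_nonneg_derivative_imp_le[OF ac' _ N]) auto
  have "absolutely_continuous_on {a..t} (\<lambda>s. - w s)"
    by (rule absolutely_continuous_on_lipschitz_compose[OF ac', where C = 1]) auto
  moreover have "((\<lambda>s. - w s) has_real_derivative 0) (at s within {a..t})" if "s \<in> {a..t} - N" for s
    using DERIV_minus[OF der'[OF that]] by simp
  ultimately have "- w a \<le> - w t"
    using t by (intro absolutely_continuous_nonneg_derivative_imp_le[where w = "\<lambda>s. - w s", OF _ _ N]) auto
  then show "w t \<le> w a" by simp
qed

text \<open>
  The difference of \<open>w\<close> and the indefinite integral of its derivative is absolutely continuous with
  derivative zero almost everywhere, hence constant.\<close>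

theorem fundamental_theorem_of_calculus_absolutely_continuous:
  fixes w :: "real \<Rightarrow> real"
  assumes ac: "absolutely_continuous_on {a..b} w" and N: "negligible N" and t: "t \<in> {a..b}"
    and h: "h absolutely_integrable_on {a..b}"
    and der: "\<And>t. t \<in> {a..b} - N \<Longrightarrow> (w has_real_derivative h t) (at t within {a..b})"
  shows "w t = w a + integral {a..t} h"
proof -
  have hi: "h integrable_on {a..b}" using h by (simp add: absolutely_integrable_on_def)
  obtain M where M: "negligible M"
    "\<forall>t\<in>{a..b} - M. ((\<lambda>t. integral {a..t} h) has_real_derivative h t) (at t within {a..b})"
    using lebesgue_differentiation_interval[OF hi] by (elim exE conjE)
  have "w t - integral {a..t} h = w a - integral {a..a} h"
  proof (rule absolutely_continuous_zero_derivative_imp_const[OF _ _ t, where w = "\<lambda>t. w t - integral {a..t} h"])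
    show "absolutely_continuous_on {a..b} (\<lambda>t. w t - integral {a..t} h)"
      by (intro absolutely_continuous_on_diff ac absolutely_continuous_on_integral h)
    show "negligible (N \<union> M)" using N M by auto
    show "((\<lambda>t. w t - integral {a..t} h) has_real_derivative 0) (at s within {a..b})"
      if "s \<in> {a..b} - (N \<union> M)" for s
      using DERIV_diff[OF der[of s] M(2)[rule_format, of s]] that by auto
  qed
  then show ?thesis by simp
qed

section \<open>Null sets and measurable composition\<close>

lemma AE_lebesgue_on_iff_negligible:
  assumes "S \<in> sets lebesgue"
  shows "(AE t in lebesgue_on S. P t) \<longleftrightarrow> (\<exists>N. negligible N \<and> (\<forall>t\<in>S - N. P t))"
proof -
  have "(AE t in lebesgue_on S. P t) \<longleftrightarrow> (AE t in lebesgue. t \<in> S \<longrightarrow> P t)"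
    using assms by (simp add: AE_restrict_space_iff)
  also have "\<dots> \<longleftrightarrow> (\<exists>N. negligible N \<and> (\<forall>t\<in>S - N. P t))"
    unfolding eventually_ae_filter negligible_iff_null_sets by auto
  finally show ?thesis .
qed

lemma AE_lebesgue_on_cong_negligible:
  assumes "S \<in> sets lebesgue" "negligible N" "\<And>t. t \<in> S - N \<Longrightarrow> P t \<longleftrightarrow> Q t"
  shows "(AE t in lebesgue_on S. P t) \<longleftrightarrow> (AE t in lebesgue_on S. Q t)"
proof -
  have "AE t in lebesgue_on S. P t \<longleftrightarrow> Q t"
    unfolding AE_lebesgue_on_iff_negligible[OF assms(1)] using assms(2,3) by blast
  then show ?thesis by (auto elim: AE_mp)
qed

text \<open>
  If \<open>p\<close> and \<open>q\<close> take only countably many values, the composition is measurable piece by piece.  In general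
  they are limits of such functions, obtained by rounding down to multiples of \<open>1/(n+1)\<close>, and
  continuity of \<open>g\<close> in its last two arguments carries measurability to the limit.\<close>

lemma borel_measurable_caratheodory_compose:
  fixes g :: "'a \<Rightarrow> real \<Rightarrow> real \<Rightarrow> real"
  assumes g: "\<And>x y. (\<lambda>t. g t x y) \<in> borel_measurable M"
    and cont: "\<And>t. t \<in> space M \<Longrightarrow> continuous_on UNIV (\<lambda>z. g t (fst z) (snd z))"
    and p[measurable]: "p \<in> borel_measurable M" and q[measurable]: "q \<in> borel_measurable M"
  shows "(\<lambda>t. g t (p t) (q t)) \<in> borel_measurable M"
proof -
  define \<rho> where "\<rho> n r = real_of_int \<lfloor>real (Suc n) * r\<rfloor> / real (Suc n)" for n r
  have "(\<lambda>n. \<rho> n r) \<longlonglongrightarrow> r" for r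
  proof (rule LIMSEQ_I)
    fix e :: real assume "e > 0"
    then obtain m where m: "1 / Suc m < e" using nat_approx_posE by metis
    have "norm (\<rho> n r - r) < e" if "m \<le> n" for n
    proof -
      have "\<rho> n r - r = (real_of_int \<lfloor>real (Suc n) * r\<rfloor> - real (Suc n) * r) / real (Suc n)"
        by (simp add: \<rho>_def field_simps)
      then have "norm (\<rho> n r - r) = \<bar>real_of_int \<lfloor>real (Suc n) * r\<rfloor> - real (Suc n) * r\<bar> / real (Suc n)"
        by simp
      also have "\<dots> \<le> 1 / real (Suc n)" by (intro divide_right_mono) linarith+
      also have "\<dots> \<le> 1 / real (Suc m)" using that by (intro divide_left_mono) auto
      finally show ?thesis using m by simp
    qed
    then show "\<exists>m. \<forall>n\<ge>m. norm (\<rho> n r - r) < e" by blast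
  qed
  note \<rho> = this
  show ?thesis
  proof (rule borel_measurable_LIMSEQ_real)
    fix n
    have "(\<lambda>t. g t (real_of_int i / real (Suc n)) (\<rho> n (q t))) \<in> borel_measurable M" for i
      unfolding \<rho>_def
      by (rule measurable_compose_countable[where g = "\<lambda>t. \<lfloor>real (Suc n) * q t\<rfloor>", OF g]) measurable
    then show "(\<lambda>t. g t (\<rho> n (p t)) (\<rho> n (q t))) \<in> borel_measurable M"
      unfolding \<rho>_def[of n "p t" for t]
      by (rule measurable_compose_countable[where g = "\<lambda>t. \<lfloor>real (Suc n) * p t\<rfloor>"]) measurable
  next
    fix t assume "t \<in> space M"
    then have "isCont (\<lambda>z. g t (fst z) (snd z)) (p t, q t)"
      using cont continuous_on_eq_continuous_at by blast
    from isCont_tendsto_compose[OF this tendsto_Pair[OF \<rho> \<rho>]]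
    show "(\<lambda>n. g t (\<rho> n (p t)) (\<rho> n (q t))) \<longlonglongrightarrow> g t (p t) (q t)" by simp
  qed
qed

section \<open>The Picard operator of a delay equation\<close>

text \<open>
  Composition with the retraction of the line onto \<open>[a,b]\<close> embeds the continuous functions on \<open>[a,b]\<close> into
  the type of bounded continuous functions on the line, whose completeness is used below.\<close>

lemma continuous_on_clamp_bcontfun:
  fixes h :: "real \<Rightarrow> real"
  assumes "continuous_on {a..b} h" "a \<le> b"
  shows "(\<lambda>t. h (max a (min b t))) \<in> bcontfun"
  unfolding bcontfun_def
proof (intro CollectI conjI)
  show "continuous_on UNIV (\<lambda>t. h (max a (min b t)))"
    using assms by (intro continuous_on_compose2[OF assms(1)] continuous_intros) auto
  have "range (\<lambda>t. h (max a (min b t))) \<subseteq> h ` {a..b}" using assms(2) by auto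
  moreover have "bounded (h ` {a..b})"
    by (intro compact_imp_bounded compact_continuous_image assms(1) compact_Icc)
  ultimately show "bounded (range (\<lambda>t. h (max a (min b t))))" using bounded_subset by blast
qed

text \<open>
  The situation of the theorem with all almost-everywhere hypotheses holding at every point of \<open>[a,b]\<close>.
  Modifying \<open>g\<close> and \<open>\<tau>\<close> on a null set leads to it and leaves the solutions unchanged.\<close>

locale delay_equation =
  fixes a b xa :: real and g :: "real \<Rightarrow> real \<Rightarrow> real \<Rightarrow> real" and \<tau> \<psi> L1 L2 :: "real \<Rightarrow> real"
  assumes a_le_b: "a \<le> b"
    and \<tau>_measurable: "\<tau> \<in> borel_measurable (lebesgue_on {a..b})"
    and \<tau>_bounds: "\<And>t. t \<in> {a..b} \<Longrightarrow> a \<le> \<tau> t \<and> \<tau> t \<le> t"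
    and g_measurable: "\<And>x y. (\<lambda>t. g t x y) \<in> borel_measurable (lebesgue_on {a..b})"
    and \<psi>_integrable: "\<psi> integrable_on {a..b}"
    and g_bound: "\<And>t x y. t \<in> {a..b} \<Longrightarrow> \<bar>g t x y\<bar> \<le> \<psi> t"
    and L1_integrable: "L1 integrable_on {a..b}" and L1_nonneg: "\<And>t. t \<in> {a..b} \<Longrightarrow> 0 \<le> L1 t"
    and L2_integrable: "L2 integrable_on {a..b}" and L2_nonneg: "\<And>t. t \<in> {a..b} \<Longrightarrow> 0 \<le> L2 t"
    and g_lipschitz: "\<And>t x y x' y'. t \<in> {a..b} \<Longrightarrow>
           \<bar>g t x y - g t x' y'\<bar> \<le> L1 t * \<bar>x - x'\<bar> + L2 t * \<bar>y - y'\<bar>"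
begin

definition rhs :: "(real \<Rightarrow> real) \<Rightarrow> real \<Rightarrow> real" where
  "rhs x s = g s (x s) (x (\<tau> s))"

definition picard :: "(real \<Rightarrow> real) \<Rightarrow> real \<Rightarrow> real" where
  "picard x t = xa + integral {a..t} (rhs x)"

definition L :: "real \<Rightarrow> real" where "L s = L1 s + L2 s"

definition \<Lambda> :: "real \<Rightarrow> real" where "\<Lambda> t = integral {a..t} L"

lemma \<tau>_in: "t \<in> {a..b} \<Longrightarrow> \<tau> t \<in> {a..b}"
  using \<tau>_bounds[of t] by auto

lemma rhs_cong:
  assumes "\<And>t. t \<in> {a..b} \<Longrightarrow> x t = y t" "s \<in> {a..b}"
  shows "rhs x s = rhs y s"
  using assms \<tau>_in unfolding rhs_def by metis

lemma picard_cong: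
  assumes "\<And>t. t \<in> {a..b} \<Longrightarrow> x t = y t" "t \<in> {a..b}"
  shows "picard x t = picard y t"
  using assms unfolding picard_def by (auto intro!: integral_cong rhs_cong)

text \<open>
  Measurability comes from the Caratheodory composition lemma, applied to the extension \<open>y\<close> of \<open>x\<close> to the
  line: since \<open>y\<close> is Borel on the whole line, \<open>y \<circ> \<tau>\<close> is Lebesgue measurable.  The function \<open>\<psi>\<close> provides the
  integrable bound.\<close>

lemma rhs_absolutely_integrable:
  assumes x: "continuous_on {a..b} x"
  shows "rhs x absolutely_integrable_on {a..b}"
proof (rule measurable_bounded_by_integrable_imp_absolutely_integrable[OF _ _ \<psi>_integrable])
  define y where "y r = x (max a (min b r))" for r
  have y: "y \<in> borel_measurable borel"
    unfolding y_def using continuous_on_clamp_bcontfun[OF x a_le_b]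
    by (intro borel_measurable_continuous_onI) (auto simp: bcontfun_def)
  have "(\<lambda>s. g s (y s) (y (\<tau> s))) \<in> borel_measurable (lebesgue_on {a..b})"
  proof (rule borel_measurable_caratheodory_compose[OF g_measurable])
    show "(\<lambda>s. y (\<tau> s)) \<in> borel_measurable (lebesgue_on {a..b})"
      by (rule measurable_compose[OF \<tau>_measurable y])
    show "y \<in> borel_measurable (lebesgue_on {a..b})"
      using measurable_compose[OF id_borel_measurable_lebesgue_on y] by simp
    fix t assume "t \<in> space (lebesgue_on {a..b})"
    then have t: "t \<in> {a..b}" by simp
    show "continuous_on UNIV (\<lambda>z. g t (fst z) (snd z))"
      unfolding continuous_on_def
    proof
      fix z :: "real \<times> real"
      show "((\<lambda>z. g t (fst z) (snd z)) \<longlongrightarrow> g t (fst z) (snd z)) (at z)"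
      proof (rule LIM_zero_cancel, rule Lim_null_comparison)
        show "\<forall>\<^sub>F w in at z. norm (g t (fst w) (snd w) - g t (fst z) (snd z))
            \<le> L1 t * \<bar>fst w - fst z\<bar> + L2 t * \<bar>snd w - snd z\<bar>"
          using g_lipschitz[OF t] by simp
        have "((\<lambda>w. L1 t * \<bar>fst w - fst z\<bar> + L2 t * \<bar>snd w - snd z\<bar>) \<longlongrightarrow>
            L1 t * \<bar>fst z - fst z\<bar> + L2 t * \<bar>snd z - snd z\<bar>) (at z)"
          by (intro tendsto_intros)
        then show "((\<lambda>w. L1 t * \<bar>fst w - fst z\<bar> + L2 t * \<bar>snd w - snd z\<bar>) \<longlongrightarrow> 0) (at z)"
          by simp
      qed
    qed
  qed
  moreover have "y s = x s" if "s \<in> {a..b}" for s using that by (simp add: y_def min_absorb2 max_absorb2)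
  ultimately show "rhs x \<in> borel_measurable (lebesgue_on {a..b})"
    using \<tau>_in by (subst measurable_cong[of _ _ "\<lambda>s. g s (y s) (y (\<tau> s))"]) (auto simp: rhs_def)
qed (use g_bound in \<open>auto simp: rhs_def\<close>)

lemma picard_continuous:
  assumes "continuous_on {a..b} x"
  shows "continuous_on {a..b} (picard x)"
  unfolding picard_def
  by (intro continuous_intros absolutely_continuous_on_imp_continuous_on
      absolutely_continuous_on_integral rhs_absolutely_integrable assms)

text \<open>
  Absolute continuity on the left is stronger than continuity on the right, but a fixed point is an
  indefinite integral and so gains it back.\<close>

lemma is_ac_solution_iff_picard_fixed_point:
  "is_ac_solution a b g \<tau> xa x \<longleftrightarrow> continuous_on {a..b} x \<and> (\<forall>t\<in>{a..b}. x t = picard x t)"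
proof
  assume "is_ac_solution a b g \<tau> xa x"
  then have ac: "absolutely_continuous_on {a..b} x" and "x a = xa"
    and ae: "AE t in lebesgue_on {a..b}. (x has_real_derivative rhs x t) (at t within {a..b})"
    by (auto simp: is_ac_solution_def rhs_def)
  have cont: "continuous_on {a..b} x" by (rule absolutely_continuous_on_imp_continuous_on[OF ac])
  obtain N where N: "negligible N" "\<forall>t\<in>{a..b} - N. (x has_real_derivative rhs x t) (at t within {a..b})"
    using ae by (auto simp: AE_lebesgue_on_iff_negligible)
  have "x t = picard x t" if t: "t \<in> {a..b}" for t
    using fundamental_theorem_of_calculus_absolutely_continuous[OF ac N(1) t rhs_absolutely_integrable[OF cont]] N(2) \<open>x a = xa\<close>
    by (simp add: picard_def)
  with cont show "continuous_on {a..b} x \<and> (\<forall>t\<in>{a..b}. x t = picard x t)" by blast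
next
  assume *: "continuous_on {a..b} x \<and> (\<forall>t\<in>{a..b}. x t = picard x t)"
  let ?F = "\<lambda>t. integral {a..t} (rhs x)"
  have abs: "rhs x absolutely_integrable_on {a..b}" using * rhs_absolutely_integrable by blast
  have x: "x t = xa + ?F t" if "t \<in> {a..b}" for t using * that by (simp add: picard_def)
  note F = absolutely_continuous_on_integral[OF abs]
  have "absolutely_continuous_on {a..b} x"
    by (rule absolutely_continuous_on_dominated[OF F F, where C = 1 and D = 1]) (auto simp: x)
  moreover have "rhs x integrable_on {a..b}" using abs by (simp add: absolutely_integrable_on_def)
  from lebesgue_differentiation_interval[OF this]
  obtain N where N: "negligible N" "\<forall>t\<in>{a..b} - N. (?F has_real_derivative rhs x t) (at t within {a..b})"
    by (elim exE conjE)
  have "(x has_real_derivative rhs x t) (at t within {a..b})" if t: "t \<in> {a..b} - N" for t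
  proof -
    have "((\<lambda>t. xa + ?F t) has_real_derivative rhs x t) (at t within {a..b})"
      using DERIV_add[OF DERIV_const N(2)[rule_format, OF t]] by simp
    then show ?thesis
      unfolding has_field_derivative_def by (rule has_derivative_transform[rotated 2]) (use t x in auto)
  qed
  then have "AE t in lebesgue_on {a..b}. (x has_real_derivative rhs x t) (at t within {a..b})"
    using N(1) by (auto simp: AE_lebesgue_on_iff_negligible)
  moreover have "x a = xa" using x[of a] a_le_b by simp
  ultimately show "is_ac_solution a b g \<tau> xa x" by (auto simp: is_ac_solution_def rhs_def)
qed

lemma L_nonneg: "t \<in> {a..b} \<Longrightarrow> 0 \<le> L t"
  using L1_nonneg L2_nonneg by (simp add: L_def)

lemma L_integrable: "L integrable_on {a..b}"
  unfolding L_def by (intro integrable_add L1_integrable L2_integrable)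

lemma L_absolutely_integrable: "L absolutely_integrable_on {a..b}"
  using L_integrable L_nonneg by (intro nonnegative_absolutely_integrable_1) auto

lemma \<Lambda>_mono: "\<lbrakk>s \<in> {a..b}; t \<in> {a..b}; s \<le> t\<rbrakk> \<Longrightarrow> \<Lambda> s \<le> \<Lambda> t"
  unfolding \<Lambda>_def using L_nonneg
  by (intro integral_subset_le integrable_on_subinterval[OF L_integrable]) auto

lemma \<Lambda>_absolutely_continuous: "absolutely_continuous_on {a..b} \<Lambda>"
  unfolding \<Lambda>_def by (intro absolutely_continuous_on_integral L_absolutely_integrable)

lemma \<Lambda>_continuous: "continuous_on {a..b} \<Lambda>"
  by (rule absolutely_continuous_on_imp_continuous_on[OF \<Lambda>_absolutely_continuous])

text \<open>
  The function \<open>exp (2 * \<Lambda>) / 2\<close> is absolutely continuous, being a composition of \<open>\<Lambda>\<close> with a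
  function that is Lipschitz on the half-line below \<open>\<Lambda> b\<close>, and the integrand is its derivative almost everywhere.\<close>

lemma weight_integral:
  shows "(\<lambda>s. L s * exp (2 * \<Lambda> s)) absolutely_integrable_on {a..b}" (is "?h absolutely_integrable_on _")
    and "t \<in> {a..b} \<Longrightarrow> integral {a..t} (\<lambda>s. L s * exp (2 * \<Lambda> s)) = (exp (2 * \<Lambda> t) - 1) / 2"
proof -
  show h: "?h absolutely_integrable_on {a..b}"
  proof (rule measurable_bounded_by_integrable_imp_absolutely_integrable)
    have [measurable]: "L \<in> borel_measurable (lebesgue_on {a..b})" "\<Lambda> \<in> borel_measurable (lebesgue_on {a..b})"
      using integrable_imp_measurable[OF L_integrable]
        continuous_imp_measurable_on_sets_lebesgue[OF \<Lambda>_continuous] by auto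
    show "?h \<in> borel_measurable (lebesgue_on {a..b})" by measurable
    show "(\<lambda>s. L s * exp (2 * \<Lambda> b)) integrable_on {a..b}"
      by (rule integrable_on_mult_left[OF L_integrable])
    show "norm (?h s) \<le> L s * exp (2 * \<Lambda> b)" if "s \<in> {a..b}" for s
      using \<Lambda>_mono[of s b] L_nonneg[OF that] that by (auto simp: abs_mult intro!: mult_left_mono)
  qed auto
  obtain N where N: "negligible N" "\<forall>t\<in>{a..b} - N. (\<Lambda> has_real_derivative L t) (at t within {a..b})"
    using lebesgue_differentiation_interval[OF L_integrable] unfolding \<Lambda>_def by (elim exE conjE)
  have ac: "absolutely_continuous_on {a..b} (\<lambda>t. exp (2 * \<Lambda> t) / 2)"
  proof (rule absolutely_continuous_on_lipschitz_compose[OF \<Lambda>_absolutely_continuous, where C = "exp (2 * \<Lambda> b)"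
        and \<phi> = "\<lambda>y. exp (2 * y) / 2"])
    have lip: "\<bar>exp (2 * y) / 2 - exp (2 * x) / 2\<bar> \<le> exp (2 * K) * \<bar>y - x\<bar>" if "x \<le> K" "y \<le> K" for x y K :: real
    proof -
      have "norm (exp (2 * y) / 2 - exp (2 * x) / 2) \<le> exp (2 * K) * norm (y - x)"
      proof (rule field_differentiable_bound[where S = "{..K}" and f' = "\<lambda>y. exp (2 * y)"])
        show "((\<lambda>y. exp (2 * y) / 2) has_field_derivative exp (2 * z)) (at z within {..K})" for z :: real
          by (auto intro!: derivative_eq_intros)
      qed (use that in auto)
      then show ?thesis by simp
    qed
    show "\<bar>exp (2 * \<Lambda> v) / 2 - exp (2 * \<Lambda> u) / 2\<bar> \<le> exp (2 * \<Lambda> b) * \<bar>\<Lambda> v - \<Lambda> u\<bar>"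
      if "u \<in> {a..b}" "v \<in> {a..b}" for u v
      using that by (intro lip \<Lambda>_mono) auto
  qed auto
  show "integral {a..t} ?h = (exp (2 * \<Lambda> t) - 1) / 2" if t: "t \<in> {a..b}"
  proof -
    have "exp (2 * \<Lambda> t) / 2 = exp (2 * \<Lambda> a) / 2 + integral {a..t} ?h"
    proof (rule fundamental_theorem_of_calculus_absolutely_continuous[OF ac N(1) t h])
      fix s assume "s \<in> {a..b} - N"
      then have "(\<Lambda> has_real_derivative L s) (at s within {a..b})" using N(2) by blast
      then show "((\<lambda>t. exp (2 * \<Lambda> t) / 2) has_real_derivative ?h s) (at s within {a..b})"
        by (auto intro!: derivative_eq_intros)
    qed
    then show ?thesis by (simp add: \<Lambda>_def field_simps)
  qed
qed

text \<open>
  The delay is harmless for the weighted bound: \<open>\<Lambda> (\<tau> s) \<le> \<Lambda> s\<close>, so the deviations at \<open>s\<close> and at \<open>\<tau> s\<close>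
  have the same bound \<open>d * exp (2 * \<Lambda> s)\<close>.\<close>

lemma picard_contraction:
  assumes x: "continuous_on {a..b} x" and y: "continuous_on {a..b} y" and "0 \<le> d"
    and le: "\<And>s. s \<in> {a..b} \<Longrightarrow> \<bar>x s - y s\<bar> \<le> d * exp (2 * \<Lambda> s)" and t: "t \<in> {a..b}"
  shows "\<bar>picard x t - picard y t\<bar> \<le> d / 2 * exp (2 * \<Lambda> t)"
proof -
  let ?h = "\<lambda>s. L s * exp (2 * \<Lambda> s)"
  have sub: "{a..t} \<subseteq> {a..b}" using t by auto
  have int: "rhs x integrable_on {a..t}" "rhs y integrable_on {a..t}" "?h integrable_on {a..t}"
    using rhs_absolutely_integrable[OF x] rhs_absolutely_integrable[OF y] weight_integral(1)
    by (auto simp: absolutely_integrable_on_def intro: integrable_on_subinterval[OF _ sub])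
  have "norm (integral {a..t} (\<lambda>s. rhs x s - rhs y s)) \<le> integral {a..t} (\<lambda>s. d * ?h s)"
  proof (rule integral_norm_bound_integral)
    fix s assume "s \<in> {a..t}"
    then have s: "s \<in> {a..b}" using sub by blast
    have "\<Lambda> (\<tau> s) \<le> \<Lambda> s" using \<tau>_bounds[OF s] \<tau>_in[OF s] s by (intro \<Lambda>_mono) auto
    then have "d * exp (2 * \<Lambda> (\<tau> s)) \<le> d * exp (2 * \<Lambda> s)" using \<open>0 \<le> d\<close> by (intro mult_left_mono) auto
    with le[OF \<tau>_in[OF s]] have "\<bar>x (\<tau> s) - y (\<tau> s)\<bar> \<le> d * exp (2 * \<Lambda> s)" by linarith
    with le[OF s] have "L1 s * \<bar>x s - y s\<bar> + L2 s * \<bar>x (\<tau> s) - y (\<tau> s)\<bar>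
        \<le> L1 s * (d * exp (2 * \<Lambda> s)) + L2 s * (d * exp (2 * \<Lambda> s))"
      using L1_nonneg[OF s] L2_nonneg[OF s] by (intro add_mono mult_left_mono) auto
    also have "\<dots> = d * ?h s" by (simp add: L_def algebra_simps)
    finally have "L1 s * \<bar>x s - y s\<bar> + L2 s * \<bar>x (\<tau> s) - y (\<tau> s)\<bar> \<le> d * ?h s" .
    with g_lipschitz[OF s] show "norm (rhs x s - rhs y s) \<le> d * ?h s"
      unfolding rhs_def real_norm_def by (rule order_trans)
  qed (intro integrable_diff int integrable_on_mult_right)+
  also have "integral {a..t} (\<lambda>s. d * ?h s) = d * ((exp (2 * \<Lambda> t) - 1) / 2)"
    by (simp add: weight_integral(2)[OF t])
  also have "\<dots> \<le> d / 2 * exp (2 * \<Lambda> t)"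
    using \<open>0 \<le> d\<close> by (simp add: field_simps)
  finally show ?thesis using int by (simp add: picard_def integral_diff)
qed

text \<open>
  Multiplication by \<open>exp (- 2 * \<Lambda>)\<close> turns the weighted norm into the supremum norm.  Conjugated in this way,
  the Picard operator is a contraction with constant \<open>1/2\<close> of the complete space of bounded continuous functions.\<close>

lemma picard_unique_fixed_point:
  obtains x where "continuous_on {a..b} x" "\<forall>t\<in>{a..b}. x t = picard x t"
    "\<forall>y. continuous_on {a..b} y \<longrightarrow> (\<forall>t\<in>{a..b}. y t = picard y t) \<longrightarrow> (\<forall>t\<in>{a..b}. y t = x t)"
proof -
  define c where "c t = max a (min b t)" for t
  have c: "c t \<in> {a..b}" for t using a_le_b by (auto simp: c_def)
  have c_id: "c t = t" if "t \<in> {a..b}" for t using that by (auto simp: c_def)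
  define unscale where "unscale z t = exp (2 * \<Lambda> t) * apply_bcontfun z t" for z t
  define scale where "scale x = Bcontfun (\<lambda>t. exp (- 2 * \<Lambda> (c t)) * x (c t))" for x
  have scale: "apply_bcontfun (scale x) t = exp (- 2 * \<Lambda> (c t)) * x (c t)"
    if "continuous_on {a..b} x" for x t
  proof -
    have "(\<lambda>t. exp (- 2 * \<Lambda> (c t)) * x (c t)) \<in> bcontfun"
      unfolding c_def
      by (rule continuous_on_clamp_bcontfun[of a b "\<lambda>t. exp (- 2 * \<Lambda> t) * x t"])
        (intro continuous_intros \<Lambda>_continuous that a_le_b)+
    then show ?thesis by (simp add: scale_def Bcontfun_inverse)
  qed
  have unscale_cont: "continuous_on {a..b} (unscale z)" for z
    unfolding unscale_def by (intro continuous_intros \<Lambda>_continuous continuous_on_apply_bcontfun)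
  have unscale_scale: "unscale (scale x) t = x t" if "continuous_on {a..b} x" "t \<in> {a..b}" for x t
    by (simp add: unscale_def scale[OF that(1)] c_id[OF that(2)] flip: mult.assoc exp_add)
  define T where "T z = scale (picard (unscale z))" for z
  have "dist (T z) (T z') \<le> 1/2 * dist z z'" for z z'
  proof (rule dist_bound)
    fix t
    have "\<bar>picard (unscale z) (c t) - picard (unscale z') (c t)\<bar> \<le> dist z z' / 2 * exp (2 * \<Lambda> (c t))"
    proof (rule picard_contraction[OF unscale_cont unscale_cont _ _ c])
      fix s
      have "\<bar>unscale z s - unscale z' s\<bar> = dist (apply_bcontfun z s) (apply_bcontfun z' s) * exp (2 * \<Lambda> s)"
        by (simp add: unscale_def dist_real_def abs_mult flip: right_diff_distrib)
      also have "\<dots> \<le> dist z z' * exp (2 * \<Lambda> s)" by (intro mult_right_mono dist_bounded) auto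
      finally show "\<bar>unscale z s - unscale z' s\<bar> \<le> dist z z' * exp (2 * \<Lambda> s)" .
    qed auto
    then have "exp (- 2 * \<Lambda> (c t)) * \<bar>picard (unscale z) (c t) - picard (unscale z') (c t)\<bar>
        \<le> exp (- 2 * \<Lambda> (c t)) * (dist z z' / 2 * exp (2 * \<Lambda> (c t)))"
      by (intro mult_left_mono) auto
    also have "\<dots> = 1/2 * dist z z'"
      by (simp add: exp_minus field_simps)
    finally show "dist (apply_bcontfun (T z) t) (apply_bcontfun (T z') t) \<le> 1/2 * dist z z'"
      unfolding T_def scale[OF picard_continuous[OF unscale_cont]]
      by (simp add: dist_real_def abs_mult flip: right_diff_distrib)
  qed
  then have "\<exists>!z. T z = z" by (intro banach_fix_type[of "1/2"]) auto
  then obtain z where z: "T z = z" and z_unique: "\<And>z'. T z' = z' \<Longrightarrow> z' = z" by blast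
  show thesis
  proof (rule that[of "unscale z"])
    show "continuous_on {a..b} (unscale z)" by (rule unscale_cont)
    show "\<forall>t\<in>{a..b}. unscale z t = picard (unscale z) t"
      using unscale_scale[OF picard_continuous[OF unscale_cont]] z unfolding T_def by metis
    show "\<forall>y. continuous_on {a..b} y \<longrightarrow> (\<forall>t\<in>{a..b}. y t = picard y t) \<longrightarrow> (\<forall>t\<in>{a..b}. y t = unscale z t)"
    proof (intro allI impI ballI)
      fix y t assume y: "continuous_on {a..b} y" "\<forall>t\<in>{a..b}. y t = picard y t" and t: "t \<in> {a..b}"
      \<comment> \<open>Any further fixed point on \<open>[a,b]\<close> rescales to a fixed point of \<open>T\<close>, so uniqueness for \<open>T\<close> is enough.\<close>
      have fixed: "picard (unscale (scale y)) t = y t" if "t \<in> {a..b}" for t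
        using picard_cong[OF unscale_scale[OF y(1)] that] y(2) that by simp
      then have "T (scale y) = scale y"
        unfolding T_def
        by (intro bcontfun_eqI) (simp add: scale[OF y(1)] scale[OF picard_continuous[OF unscale_cont]] fixed[OF c])
      then have "scale y = z" by (rule z_unique)
      then show "y t = unscale z t" using unscale_scale[OF y(1) t] by simp
    qed
  qed
qed

end

section \<open>Existence and uniqueness under almost-everywhere hypotheses\<close>

theorem theorem2p1:
  fixes a b xa :: real
    and g :: "real \<Rightarrow> real \<Rightarrow> real \<Rightarrow> real"
    and \<tau> \<psi> L1 L2 :: "real \<Rightarrow> real"
  assumes "a \<le> b"
    and "\<tau> \<in> {a..b} \<rightarrow> {a..b}"
    and "\<tau> \<in> borel_measurable (lebesgue_on {a..b})"
    and "AE t in lebesgue_on {a..b}. \<tau> t \<le> t"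
    and "\<And>x y. (\<lambda>t. g t x y) \<in> borel_measurable (lebesgue_on {a..b})"
    and "integrable (lebesgue_on {a..b}) \<psi>"
    and "AE t in lebesgue_on {a..b}. \<forall>x y. \<bar>g t x y\<bar> \<le> \<psi> t"
    and "integrable (lebesgue_on {a..b}) L1" and "\<forall>t\<in>{a..b}. 0 \<le> L1 t"
    and "integrable (lebesgue_on {a..b}) L2" and "\<forall>t\<in>{a..b}. 0 \<le> L2 t"
    and "AE t in lebesgue_on {a..b}. \<forall>x y x' y'.
           \<bar>g t x y - g t x' y'\<bar> \<le> L1 t * \<bar>x - x'\<bar> + L2 t * \<bar>y - y'\<bar>"
  shows "\<exists>!x. x \<in> extensional {a..b} \<and> is_ac_solution a b g \<tau> xa x"
proof -
  have I: "{a..b} \<in> sets lebesgue" by simp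
  have "\<exists>N. negligible N \<and> (\<forall>t\<in>{a..b} - N. \<tau> t \<le> t)"
    using assms(4) unfolding AE_lebesgue_on_iff_negligible[OF I] .
  then obtain N1 where N1: "negligible N1" "\<forall>t\<in>{a..b} - N1. \<tau> t \<le> t" by (elim exE conjE)
  have "\<exists>N. negligible N \<and> (\<forall>t\<in>{a..b} - N. \<forall>x y. \<bar>g t x y\<bar> \<le> \<psi> t)"
    using assms(7) unfolding AE_lebesgue_on_iff_negligible[OF I] .
  then obtain N2 where N2: "negligible N2" "\<forall>t\<in>{a..b} - N2. \<forall>x y. \<bar>g t x y\<bar> \<le> \<psi> t"
    by (elim exE conjE)
  have "\<exists>N. negligible N \<and> (\<forall>t\<in>{a..b} - N. \<forall>x y x' y'.
           \<bar>g t x y - g t x' y'\<bar> \<le> L1 t * \<bar>x - x'\<bar> + L2 t * \<bar>y - y'\<bar>)"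
    using assms(12) unfolding AE_lebesgue_on_iff_negligible[OF I] .
  then obtain N3 where N3: "negligible N3" "\<forall>t\<in>{a..b} - N3. \<forall>x y x' y'.
           \<bar>g t x y - g t x' y'\<bar> \<le> L1 t * \<bar>x - x'\<bar> + L2 t * \<bar>y - y'\<bar>"
    by (elim exE conjE)
  \<comment> \<open>One null set for all three hypotheses; \<open>g'\<close> vanishes on it, and off it \<open>g'\<close> and \<open>\<tau>'\<close> agree with \<open>g\<close> and \<open>\<tau>\<close>.\<close>
  define N where "N = N1 \<union> N2 \<union> N3"
  have N: "negligible N" unfolding N_def by (intro negligible_Un N1 N2 N3)
  define g' where "g' t x y = indicator (- N) t * g t x y" for t x y
  define \<tau>' where "\<tau>' t = min (\<tau> t) t" for t
  have g'_off: "g' t x y = g t x y" if "t \<notin> N" for t x y using that by (simp add: g'_def)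
  have g'_on: "g' t x y = 0" if "t \<in> N" for t x y using that by (simp add: g'_def)
  have \<tau>'_off: "\<tau>' t = \<tau> t" if "t \<in> {a..b} - N" for t
  proof -
    have "\<tau> t \<le> t" using N1(2) that by (simp add: N_def)
    then show ?thesis by (simp add: \<tau>'_def)
  qed
  have integrable: "f integrable_on {a..b}" if "integrable (lebesgue_on {a..b}) f" for f :: "real \<Rightarrow> real"
    using that by (rule integrable_on_lebesgue_on[OF _ I])
  interpret delay_equation a b xa g' \<tau>' "\<lambda>t. \<bar>\<psi> t\<bar>" L1 L2
  proof
    have "(\<lambda>t. t) \<in> borel_measurable (lebesgue_on {a..b})"
      using id_borel_measurable_lebesgue_on[of "{a..b}"] by (simp add: id_def)
    then show "\<tau>' \<in> borel_measurable (lebesgue_on {a..b})"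
      unfolding \<tau>'_def by (intro borel_measurable_min assms(3))
    show "a \<le> \<tau>' t \<and> \<tau>' t \<le> t" if "t \<in> {a..b}" for t
      using that assms(2) by (auto simp: \<tau>'_def Pi_iff)
    have "- N \<in> sets lebesgue" using sets.compl_sets[OF negligible_imp_sets[OF N]] by (simp add: Compl_eq_Diff_UNIV)
    then have "indicator (- N) \<in> borel_measurable (lebesgue_on {a..b})"
      by (rule measurable_restrict_space1[OF borel_measurable_indicator])
    then show "(\<lambda>t. g' t x y) \<in> borel_measurable (lebesgue_on {a..b})" for x y
      unfolding g'_def by (intro borel_measurable_times assms(5))
    show "(\<lambda>t. \<bar>\<psi> t\<bar>) integrable_on {a..b}"
      by (rule integrable[OF integrable_abs[OF assms(6)]])
    show "\<bar>g' t x y\<bar> \<le> \<bar>\<psi> t\<bar>" if "t \<in> {a..b}" for t x y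
    proof (cases "t \<in> N")
      case False
      then have "\<bar>g t x y\<bar> \<le> \<psi> t" using N2(2) that by (simp add: N_def)
      then show ?thesis using False by (simp add: g'_off)
    qed (simp add: g'_on)
    show "\<bar>g' t x y - g' t x' y'\<bar> \<le> L1 t * \<bar>x - x'\<bar> + L2 t * \<bar>y - y'\<bar>" if t: "t \<in> {a..b}" for t x y x' y'
    proof (cases "t \<in> N")
      case True
      then show ?thesis using assms(9,11) t by (simp add: g'_on)
    next
      case False
      then show ?thesis using N3(2) t by (simp add: N_def g'_off)
    qed
    show "a \<le> b" by (rule assms(1))
    show "L1 integrable_on {a..b}" "L2 integrable_on {a..b}"
      by (rule integrable[OF assms(8)], rule integrable[OF assms(10)])
    show "0 \<le> L1 t" "0 \<le> L2 t" if "t \<in> {a..b}" for t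
      using assms(9,11) that by blast+
  qed
  have same_solutions: "is_ac_solution a b g \<tau> xa x \<longleftrightarrow> is_ac_solution a b g' \<tau>' xa x" for x
  proof -
    have "(AE t in lebesgue_on {a..b}. (x has_real_derivative g t (x t) (x (\<tau> t))) (at t within {a..b})) \<longleftrightarrow>
       (AE t in lebesgue_on {a..b}. (x has_real_derivative g' t (x t) (x (\<tau>' t))) (at t within {a..b}))"
      by (rule AE_lebesgue_on_cong_negligible[OF I N]) (simp add: \<tau>'_off g'_off)
    then show ?thesis by (simp add: is_ac_solution_def)
  qed
  obtain x where x: "continuous_on {a..b} x" "\<forall>t\<in>{a..b}. x t = picard x t"
    "\<forall>y. continuous_on {a..b} y \<longrightarrow> (\<forall>t\<in>{a..b}. y t = picard y t) \<longrightarrow> (\<forall>t\<in>{a..b}. y t = x t)"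
    by (rule picard_unique_fixed_point)
  show ?thesis
    unfolding same_solutions is_ac_solution_iff_picard_fixed_point
  proof (rule ex1I[of _ "restrict x {a..b}"])
    have "continuous_on {a..b} (restrict x {a..b})"
      by (subst continuous_on_cong[OF refl, where g = x]) (simp_all add: x(1))
    moreover have "\<forall>t\<in>{a..b}. restrict x {a..b} t = picard (restrict x {a..b}) t"
    proof
      fix t assume t: "t \<in> {a..b}"
      have "picard (restrict x {a..b}) t = picard x t"
        by (rule picard_cong[OF _ t]) simp
      then show "restrict x {a..b} t = picard (restrict x {a..b}) t"
        using x(2) t by simp
    qed
    ultimately show "restrict x {a..b} \<in> extensional {a..b} \<and> continuous_on {a..b} (restrict x {a..b}) \<and>
        (\<forall>t\<in>{a..b}. restrict x {a..b} t = picard (restrict x {a..b}) t)"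
      by (intro conjI restrict_extensional)
  next
    fix y assume y: "y \<in> extensional {a..b} \<and> continuous_on {a..b} y \<and> (\<forall>t\<in>{a..b}. y t = picard y t)"
    then have eq: "\<forall>t\<in>{a..b}. y t = x t" using x(3) by blast
    show "y = restrict x {a..b}"
    proof (rule extensionalityI[where A = "{a..b}"])
      show "y \<in> extensional {a..b}" using y by (rule conjunct1)
      show "y t = restrict x {a..b} t" if "t \<in> {a..b}" for t using eq that by simp
    qed (rule restrict_extensional)
  qed
qed

end
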